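(* Let $(A_n)_{n\ge 0}$ be the sequence determined by $A_0=1,\ A_1=4,\ A_2=20,\ A_3=128$ and, for all $n\ge 4$, $$(-256+384n-192n^2+32n^3)A_{n-4}+(480-896n+576n^2-128n^3)A_{n-3}+(-160+384n-336n^2+112n^3)A_{n-2}+(8-32n+48n^2-32n^3)A_{n-1}+2n^3A_n=0.$$ Then $$\frac1\pi=\sum_{n=0}^{\infty}A_n\,(Bn+C)\left(\frac{5-2\sqrt6}{2}\right)^n,$$ where $$B=2(-2+\sqrt6)\sqrt{15-6\sqrt6},\qquad C=2(-12+5\sqrt6)\sqrt{\tfrac13(5-2\sqrt6)}.$$
   Context: All square roots are the nonnegative real square roots. (This is the level $16$ series, for the group $16+$.) *)

theory Defs
  imports Complex_Main
begin

end

theory Submission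
  imports Defs "HOL-Analysis.Analysis"
begin

text \<open>
  The generating function \<open>F(x) = \<Sum>n. A n * x ^ n\<close> is a rational pullback of the series of the cubes
  of the central binomial coefficients:
  \<open>F(x) = (\<Sum>k. (2*k choose k) ^ 3 * t ^ k) / (1 - 2*x) ^ 2\<close> with \<open>t = x ^ 2 / (1 - 2*x) ^ 4\<close>.
  At \<open>z = (5 - 2 * sqrt 6) / 2\<close> one has \<open>(1 - 2*z) ^ 2 = 16 * z\<close>, hence \<open>t = 1/256\<close>, and the claim becomes
  Ramanujan's series \<open>(\<Sum>k. (2*k choose k) ^ 3 * (6*k + 1) / 256 ^ k) = 4 / pi\<close>.

  Ramanujan's series (lemma \<open>ramanujan_series\<close>) is inserted as the case \<open>k = 0\<close> of a family of
  series whose sum is independent of \<open>k\<close>, because the terms form a Wilf-Zeilberger pair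
  (\<open>wz_pair\<close>). As \<open>k\<close> grows only the first term of the series survives, and its limit is
  given by Wallis' product.

  For the pullback, let \<open>f k\<close> be the formal power series \<open>t ^ k / (1 - 2*x) ^ 2\<close>. The differential operator
  behind the recurrence sends \<open>f k\<close> to a multiple of \<open>k ^ 3 * f k - 8 * (2*k + 1) ^ 3 * f (k + 1)\<close>, with
  a factor that does not depend on \<open>k\<close> (\<open>rec_op_basis_fps\<close>). With the weights \<open>(2*k choose k) ^ 3\<close>
  these images telescope, so the coefficients of the pullback satisfy the recurrence
  (\<open>series_coeff_rec\<close>) and agree with \<open>A\<close>.

  Finally, \<open>B\<close> and \<open>C\<close> are positive and the coefficients of all \<open>f k\<close> are nonnegative, so the
  double series over \<open>n\<close> and \<open>k\<close> may be summed in either order (\<open>sums_swap_nonneg\<close>). Summing over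
  \<open>n\<close> first, each row has an elementary value, and the values of \<open>B\<close> and \<open>C\<close> are those
  for which it equals a quarter of the corresponding term of Ramanujan's series.
\<close>

section \<open>Ramanujan's series with ratio 1/4\<close>

text \<open>This number is \<open>(2*k choose k) / 4 ^ k\<close>.\<close>

definition half_coeff :: "nat \<Rightarrow> real" where
  "half_coeff k = pochhammer (1/2) k / fact k"

lemma half_coeff_0 [simp]: "half_coeff 0 = 1"
  by (simp add: half_coeff_def)

lemma half_coeff_Suc: "half_coeff (Suc k) = half_coeff k * (2 * real k + 1) / (2 * real k + 2)"
  by (simp add: half_coeff_def pochhammer_Suc field_simps)

lemma half_coeff_nonneg: "half_coeff k \<ge> 0"
  by (induction k) (simp_all add: half_coeff_Suc)

lemma half_coeff_le_1: "half_coeff k \<le> 1"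
proof (induction k)
  case (Suc k)
  have "half_coeff k * ((2 * real k + 1) / (2 * real k + 2)) \<le> 1 * 1"
    using Suc half_coeff_nonneg by (intro mult_mono) auto
  then show ?case by (simp add: half_coeff_Suc)
qed simp

text \<open>The left-hand side is the reciprocal of a partial product of Wallis' product.\<close>

lemma half_coeff_wallis: "(\<lambda>k. (half_coeff k)\<^sup>2 * (2 * real k + 1)) \<longlonglongrightarrow> 2 / pi"
proof -
  have "(half_coeff n)\<^sup>2 * (2 * real n + 1) =
      inverse (\<Prod>k=1..n. (4 * real k ^ 2) / (4 * real k ^ 2 - 1))" for n
  proof (induction n)
    case (Suc n)
    have nz: "4 * (real n + 1)\<^sup>2 - 1 = (2 * real n + 1) * (2 * real n + 3)"
      by (simp add: algebra_simps power2_eq_square)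
    have "(half_coeff (Suc n))\<^sup>2 * (2 * real (Suc n) + 1) =
        ((half_coeff n)\<^sup>2 * (2 * real n + 1)) * 
          (((2 * real n + 1) * (2 * real n + 3)) / (4 * (real n + 1)\<^sup>2))"
      by (simp add: half_coeff_Suc divide_simps) (simp add: algebra_simps power2_eq_square)
    also have "\<dots> = inverse (\<Prod>k=1..Suc n. (4 * real k ^ 2) / (4 * real k ^ 2 - 1))"
      unfolding Suc nz[symmetric] by (simp add: add.commute divide_simps)
    finally show ?case .
  qed simp
  then show ?thesis
    using tendsto_inverse[OF wallis] by simp
qed

text \<open>
  In terms of rising factorials, this is
  \<open>(1/2)_n ^ 3 / (n! * (1+k)_n ^ 2 * 4 ^ n)\<close>, a deformation of the term of Ramanujan's series,
  times \<open>((1/2)_k / k!) ^ 2\<close>, which makes the sum over \<open>n\<close> independent of \<open>k\<close>.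
\<close>

definition wz_term :: "nat \<Rightarrow> nat \<Rightarrow> real" where
  "wz_term n k = half_coeff n ^ 3 * (half_coeff k)\<^sup>2 / 4 ^ n
     * (fact n * fact k / fact (n + k))\<^sup>2"

lemma wz_term_Suc_n:
  "wz_term (Suc n) k = wz_term n k * (2 * real n + 1) ^ 3
     / (32 * (real n + 1) * (real n + real k + 1)\<^sup>2)"
proof -
  have *: "fact (Suc n) * fact k / fact (Suc n + k) =
      (fact n * fact k / fact (n + k)) * ((real n + 1) / (real n + real k + 1))"
    by (simp add: field_simps)
  have **: "2 * real n + 2 = 2 * (real n + 1)" by simp
  show ?thesis
    unfolding wz_term_def * half_coeff_Suc **
    by (simp add: divide_simps power2_eq_square power3_eq_cube) (simp add: algebra_simps)
qed

lemma wz_term_Suc_k: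
  "wz_term n (Suc k) = wz_term n k * ((2 * real k + 1) / (2 * (real n + real k + 1)))\<^sup>2"
proof -
  have *: "fact n * fact (Suc k) / fact (n + Suc k) =
      (fact n * fact k / fact (n + k)) * ((real k + 1) / (real n + real k + 1))"
    by (simp add: field_simps)
  have **: "2 * real k + 2 = 2 * (real k + 1)" by simp
  show ?thesis
    unfolding wz_term_def * half_coeff_Suc **
    by (simp add: divide_simps power2_eq_square power3_eq_cube) (simp add: algebra_simps)
qed

text \<open>
  A Wilf-Zeilberger pair with companion \<open>8 * n * wz_term n k\<close>: after division by \<open>wz_term n k\<close> both sides are
  rational functions. The right-hand side telescopes in \<open>n\<close> and vanishes at \<open>n = 0\<close>, so the sum
  of \<open>wz_term n k * (6 * n + 4 * k + 1)\<close> over \<open>n\<close> is the same for \<open>k\<close> and \<open>k + 1\<close>.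
\<close>

lemma wz_pair:
  "wz_term n (Suc k) * (6 * real n + 4 * real (Suc k) + 1)
     - wz_term n k * (6 * real n + 4 * real k + 1)
   = 8 * real (Suc n) * wz_term (Suc n) k - 8 * real n * wz_term n k"
proof -
  define a b where "a = real n" and "b = real k"
  have ab: "a \<ge> 0" "b \<ge> 0" by (auto simp: a_def b_def)
  have "((2 * b + 1) / (2 * (a + b + 1)))\<^sup>2 * (6 * a + 4 * (b + 1) + 1) - (6 * a + 4 * b + 1)
      = 8 * (a + 1) * ((2 * a + 1) ^ 3 / (32 * (a + 1) * (a + b + 1)\<^sup>2)) - 8 * a"
    using ab by (simp add: divide_simps add_eq_0_iff)
      (simp add: power2_eq_square power3_eq_cube algebra_simps)
  then show ?thesis
    unfolding wz_term_Suc_n wz_term_Suc_k a_def b_def of_nat_Suc times_divide_eq_right[symmetric]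
    by algebra
qed

text \<open>
  The first upper bound makes the series converge for fixed \<open>k\<close>. The second one, in which
  \<open>1 + k\<close> is a lower bound of the binomial coefficient in the denominator, shows that all terms
  but the first vanish as \<open>k\<close> grows, even after multiplication by \<open>4 * k\<close>.
\<close>

lemma wz_term_bounds:
  "0 \<le> wz_term n k" "wz_term n k \<le> (half_coeff k)\<^sup>2 / 4 ^ n"
  "n \<ge> 1 \<Longrightarrow> wz_term n k \<le> (half_coeff k)\<^sup>2 / 4 ^ n / (1 + real k)\<^sup>2"
proof -
  let ?q = "fact n * fact k / fact (n + k) :: real"
  show nn: "0 \<le> wz_term n k"
    by (simp add: wz_term_def half_coeff_nonneg)
  have h: "wz_term n k \<le> (half_coeff k)\<^sup>2 / 4 ^ n * ?q\<^sup>2"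
  proof -
    have "half_coeff n ^ 3 * ((half_coeff k)\<^sup>2 / 4 ^ n * ?q\<^sup>2) \<le> 1 * ((half_coeff k)\<^sup>2 / 4 ^ n * ?q\<^sup>2)"
      by (intro mult_right_mono power_le_one half_coeff_nonneg half_coeff_le_1) auto
    then show ?thesis by (simp add: wz_term_def mult_ac)
  qed
  have q: "?q = 1 / real (n + k choose n)"
    by (simp add: binomial_fact)
  have "1 \<le> real (n + k choose n)"
    by (metis le_add1 of_nat_1 of_nat_le_iff One_nat_def Suc_leI zero_less_binomial)
  then have "?q \<le> 1" unfolding q by simp
  then have "?q\<^sup>2 \<le> 1" by (intro power_le_one) auto
  then have "(half_coeff k)\<^sup>2 / 4 ^ n * ?q\<^sup>2 \<le> (half_coeff k)\<^sup>2 / 4 ^ n * 1"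
    by (intro mult_left_mono) auto
  with h show "wz_term n k \<le> (half_coeff k)\<^sup>2 / 4 ^ n" by simp
  assume n: "n \<ge> 1"
  have "1 + k \<le> n + k choose n"
  proof -
    have "(1 + k choose k) \<le> (n + k choose k)"
      using n by (intro binomial_right_mono) auto
    then show ?thesis
      by (metis add.commute add_diff_cancel_left' binomial_symmetric le_add2 binomial_Suc_n plus_1_eq_Suc)
  qed
  then have "1 + real k \<le> real (n + k choose n)"
    by (metis of_nat_1 of_nat_add of_nat_le_iff)
  then have "?q \<le> 1 / (1 + real k)" unfolding q by (intro divide_left_mono) auto
  then have "?q\<^sup>2 \<le> (1 / (1 + real k))\<^sup>2" by (intro power_mono) auto
  then have "(half_coeff k)\<^sup>2 / 4 ^ n * ?q\<^sup>2 \<le> (half_coeff k)\<^sup>2 / 4 ^ n * (1 / (1 + real k))\<^sup>2"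
    by (intro mult_left_mono) auto
  with h show "wz_term n k \<le> (half_coeff k)\<^sup>2 / 4 ^ n / (1 + real k)\<^sup>2" 
    by (simp add: power_divide)
qed

lemma summable_linear_quarter: "summable (\<lambda>n. (6 * real n + c) / 4 ^ n)"
proof -
  have "summable (\<lambda>n. of_nat (Suc n) * (1/4 :: real) ^ n)"
    using geometric_deriv_sums[of "1/4 :: real"] by (simp add: sums_iff)
  moreover have "summable (\<lambda>n. (1/4 :: real) ^ n)" by simp
  ultimately have "summable (\<lambda>n. 6 * (of_nat (Suc n) * (1/4 :: real) ^ n) + (c - 6) * (1/4) ^ n)"
    by (intro summable_add summable_mult)
  then show ?thesis by (simp add: add_divide_distrib power_divide algebra_simps diff_divide_distrib)
qed

definition wz_sum :: "nat \<Rightarrow> real" where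
  "wz_sum k = (\<Sum>n. wz_term n k * (6 * real n + 4 * real k + 1))"

lemma summable_wz: "summable (\<lambda>n. wz_term n k * (6 * real n + 4 * real k + 1))"
proof (rule summable_comparison_test')
  show "summable (\<lambda>n. (half_coeff k)\<^sup>2 * ((6 * real n + (4 * real k + 1)) / 4 ^ n))"
    by (intro summable_mult summable_linear_quarter)
  show "norm (wz_term n k * (6 * real n + 4 * real k + 1))
      \<le> (half_coeff k)\<^sup>2 * ((6 * real n + (4 * real k + 1)) / 4 ^ n)" if "n \<ge> 0" for n
    using mult_right_mono[OF wz_term_bounds(2), of "6 * real n + 4 * real k + 1" n k]
      wz_term_bounds(1)[of n k]
    by (simp add: abs_mult add.assoc)
qed

lemma wz_companion_tendsto_0: "(\<lambda>n. 8 * real n * wz_term n k) \<longlonglongrightarrow> 0"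
proof (rule Lim_null_comparison)
  show "\<forall>\<^sub>F n in sequentially. norm (8 * real n * wz_term n k)
      \<le> 2 * (wz_term n k * (6 * real n + 4 * real k + 1))"
  proof (intro always_eventually allI)
    fix n
    have "8 * real n * wz_term n k \<le> 2 * (6 * real n + 4 * real k + 1) * wz_term n k"
      by (intro mult_right_mono wz_term_bounds) auto
    then show "norm (8 * real n * wz_term n k) \<le> 2 * (wz_term n k * (6 * real n + 4 * real k + 1))"
      using wz_term_bounds(1)[of n k] by (simp add: abs_mult algebra_simps)
  qed
  show "(\<lambda>n. 2 * (wz_term n k * (6 * real n + 4 * real k + 1))) \<longlonglongrightarrow> 0"
    using tendsto_mult_left[OF summable_LIMSEQ_zero[OF summable_wz[of k]], of 2] by simp
qed

lemma wz_sum_Suc: "wz_sum (Suc k) = wz_sum k"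
proof -
  have "(\<lambda>n. 8 * real (Suc n) * wz_term (Suc n) k - 8 * real n * wz_term n k) sums
      (0 - 8 * real 0 * wz_term 0 k)"
    by (rule telescope_sums) (rule wz_companion_tendsto_0)
  then have "(\<lambda>n. wz_term n (Suc k) * (6 * real n + 4 * real (Suc k) + 1)
     - wz_term n k * (6 * real n + 4 * real k + 1)) sums 0"
    unfolding wz_pair by simp
  moreover have "(\<lambda>n. wz_term n (Suc k) * (6 * real n + 4 * real (Suc k) + 1)
     - wz_term n k * (6 * real n + 4 * real k + 1)) sums (wz_sum (Suc k) - wz_sum k)"
    unfolding wz_sum_def by (intro sums_diff summable_sums summable_wz)
  ultimately show ?thesis using sums_unique2 by fastforce
qed

text \<open>
  The term with \<open>n = 0\<close> is \<open>(half_coeff k)\<^sup>2 * (4 * k + 1)\<close> and tends to \<open>4 / pi\<close> by Wallis' product;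
  the rest of the series is at most \<open>M / (1 + k)\<close>.
\<close>

lemma wz_sum_tendsto: "wz_sum \<longlonglongrightarrow> 4 / pi"
proof -
  define M where "M = (\<Sum>n. (6 * real n + 10) / 4 ^ n :: real)"
  have head: "(\<lambda>k. (half_coeff k)\<^sup>2 * (4 * real k + 1)) \<longlonglongrightarrow> 4 / pi"
  proof -
    have "(\<lambda>k. ((half_coeff k)\<^sup>2 * (2 * real k + 1)) * (2 - 1 / real (Suc (2 * k))))
        \<longlonglongrightarrow> (2 / pi) * (2 - 0)"
    proof (intro tendsto_intros half_coeff_wallis)
      have "filterlim (\<lambda>k. Suc (2 * k)) sequentially sequentially"
        by (rule filterlim_subseq) (simp add: strict_mono_def)
      then show "(\<lambda>k. 1 / real (Suc (2 * k))) \<longlonglongrightarrow> 0"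
        by (rule filterlim_compose[OF lim_1_over_n])
    qed
    moreover have "((half_coeff k)\<^sup>2 * (2 * real k + 1)) * (2 - 1 / real (Suc (2 * k)))
        = (half_coeff k)\<^sup>2 * (4 * real k + 1)" for k
      by (simp add: divide_simps) (simp add: algebra_simps)
    ultimately show ?thesis by (simp only: diff_zero) simp
  qed
  have tail: "norm (wz_sum k - (half_coeff k)\<^sup>2 * (4 * real k + 1)) \<le> M / (1 + real k)" for k
  proof -
    let ?f = "\<lambda>n. wz_term (Suc n) k * (6 * real (Suc n) + 4 * real k + 1)"
    have eq: "wz_sum k - (half_coeff k)\<^sup>2 * (4 * real k + 1) = suminf ?f"
      using suminf_split_head[OF summable_wz[of k]]
      by (simp add: wz_sum_def wz_term_def)
    have sf: "summable ?f"
      using summable_wz[of k] by (subst summable_Suc_iff)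
    have le: "?f n \<le> ((6 * real n + 10) / 4 ^ n) / (1 + real k)" for n
    proof -
      have "wz_term (Suc n) k \<le> (half_coeff k)\<^sup>2 / 4 ^ Suc n / (1 + real k)\<^sup>2"
        by (rule wz_term_bounds) simp
      also have "\<dots> \<le> 1 / 4 ^ n / (1 + real k)\<^sup>2"
      proof (intro divide_right_mono frac_le)
        show "(half_coeff k)\<^sup>2 \<le> 1"
          by (intro power_le_one half_coeff_nonneg half_coeff_le_1)
      qed auto
      finally have 1: "wz_term (Suc n) k \<le> 1 / 4 ^ n / (1 + real k)\<^sup>2" .
      have "6 * real (Suc n) + 4 * real k + 1 \<le> (6 * real n + 10) * (1 + real k)"
        by (simp add: algebra_simps)
      then have "?f n \<le> 1 / 4 ^ n / (1 + real k)\<^sup>2 * ((6 * real n + 10) * (1 + real k))"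
        using 1 by (intro mult_mono) auto
      also have "\<dots> = ((6 * real n + 10) / 4 ^ n) / (1 + real k)"
        by (simp add: divide_simps power2_eq_square)
      finally show ?thesis .
    qed
    have "suminf ?f \<le> (\<Sum>n. ((6 * real n + 10) / 4 ^ n) / (1 + real k))"
      by (intro suminf_le le sf summable_divide summable_linear_quarter)
    also have "\<dots> = M / (1 + real k)"
      unfolding M_def by (rule suminf_divide) (rule summable_linear_quarter)
    finally have "suminf ?f \<le> M / (1 + real k)" .
    moreover have "0 \<le> suminf ?f"
      by (intro suminf_nonneg sf) (simp add: wz_term_bounds)
    ultimately show ?thesis by (simp add: eq)
  qed
  have "(\<lambda>k. wz_sum k - (half_coeff k)\<^sup>2 * (4 * real k + 1)) \<longlonglongrightarrow> 0"
  proof (rule Lim_null_comparison)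
    show "\<forall>\<^sub>F k in sequentially.
        norm (wz_sum k - (half_coeff k)\<^sup>2 * (4 * real k + 1)) \<le> M / (1 + real k)"
      by (intro always_eventually allI tail)
    show "(\<lambda>k. M / (1 + real k)) \<longlonglongrightarrow> 0"
      using tendsto_mult_left[OF LIMSEQ_inverse_real_of_nat, of M]
      by (simp add: divide_inverse add.commute)
  qed
  from tendsto_add[OF this head] show ?thesis by simp
qed

lemma ramanujan_series: "(\<lambda>n. half_coeff n ^ 3 * (6 * real n + 1) / 4 ^ n) sums (4 / pi)"
proof -
  have "wz_sum k = wz_sum 0" for k
    by (induction k) (simp_all add: wz_sum_Suc)
  then have "wz_sum = (\<lambda>_. wz_sum 0)" by auto
  then have "wz_sum 0 = 4 / pi"
    using wz_sum_tendsto by (metis LIMSEQ_const_iff)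
  then show ?thesis
    using summable_sums[OF summable_wz[of 0]] by (simp add: wz_sum_def wz_term_def)
qed

section \<open>The differential operator of the recurrence\<close>

definition geo2 :: "real fps" where "geo2 = Abs_fps (\<lambda>n. 2 ^ n)"

lemma geo2_inverse: "geo2 * (1 - 2 * fps_X) = 1"
proof (rule fps_ext)
  fix n
  have "geo2 * (1 - 2 * fps_X) = geo2 - fps_const 2 * (geo2 * fps_X)"
    by (simp add: algebra_simps numeral_fps_const)
  then have "fps_nth (geo2 * (1 - 2 * fps_X)) n = fps_nth geo2 n - 2 * fps_nth (geo2 * fps_X) n"
    by simp
  then show "fps_nth (geo2 * (1 - 2 * fps_X)) n = fps_nth 1 n"
    by (cases n) (simp_all add: geo2_def)
qed

lemma fps_XD_mult: "fps_XD (f * g) = fps_XD f * g + f * fps_XD (g :: 'a :: comm_ring_1 fps)"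
  by (simp add: fps_XD_def algebra_simps)

lemma fps_XD_geo2: "fps_XD geo2 = 2 * fps_X * geo2 ^ 2"
proof -
  have "fps_XD (geo2 * (1 - 2 * fps_X)) = 0"
    unfolding geo2_inverse by (simp add: fps_XD_def)
  moreover have "fps_XD (1 - 2 * fps_X) = - (2 * fps_X :: real fps)"
    by (simp add: fps_XD_def numeral_fps_const)
  ultimately have "fps_XD geo2 * (1 - 2 * fps_X) = 2 * fps_X * geo2"
    unfolding fps_XD_mult by algebra
  then show ?thesis using geo2_inverse by algebra
qed

definition kern :: "nat \<Rightarrow> nat \<Rightarrow> real fps" where
  "kern a b = fps_X ^ a * geo2 ^ b"

text \<open>
  Every \<open>fps_X ^ a * geo2 ^ b\<close> is multiplied by a polynomial in \<open>w = fps_X * geo2\<close> under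
  \<open>fps_X * d/dX\<close>, and so is \<open>w\<close> itself. This turns the differential operator below into algebra.
\<close>

lemma fps_XD_kern: "fps_XD (kern a b) = (of_nat a + 2 * of_nat b * (fps_X * geo2)) * kern a b"
proof -
  have X: "fps_XD (fps_X ^ a) = of_nat a * (fps_X ^ a :: real fps)"
  proof (induction a)
    case (Suc a)
    have "fps_XD (fps_X :: real fps) = fps_X" by (simp add: fps_XD_def)
    then show ?case by (simp add: fps_XD_mult Suc algebra_simps)
  qed (simp add: fps_XD_def)
  have g: "fps_XD (geo2 ^ b) = 2 * of_nat b * (fps_X * geo2) * geo2 ^ b"
  proof (induction b)
    case (Suc b)
    show ?case by (simp add: fps_XD_mult Suc fps_XD_geo2 power2_eq_square algebra_simps)
  qed (simp add: fps_XD_def)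
  show ?thesis
    unfolding kern_def fps_XD_mult X g by (simp add: algebra_simps)
qed

lemma fps_XD_of_nat [simp]: "fps_XD (of_nat n :: real fps) = 0" 
  by (simp add: fps_XD_def fps_of_nat[symmetric])

lemma fps_XD_numeral [simp]: "fps_XD (numeral n :: real fps) = 0" 
  by (simp add: fps_XD_def numeral_fps_const)

lemma fps_XD_w: "fps_XD (fps_X * geo2) = (fps_X * geo2) * (1 + 2 * (fps_X * geo2))"
  using fps_XD_kern[of 1 1] by (simp add: kern_def mult_ac)

lemma fps_XD_XD_kern:
  fixes a b :: nat
  defines "w \<equiv> fps_X * geo2"
  defines "e \<equiv> of_nat a + 2 * of_nat b * w"
  shows "fps_XD (fps_XD (kern a b)) = (e\<^sup>2 + 2 * of_nat b * w * (1 + 2 * w)) * kern a b"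
    and "fps_XD (fps_XD (fps_XD (kern a b))) =
      (e ^ 3 + 6 * of_nat b * e * w * (1 + 2 * w) + 2 * of_nat b * w * (1 + 2 * w) * (1 + 4 * w))
        * kern a b"
proof -
  have w: "fps_XD w = w * (1 + 2 * w)" unfolding w_def by (rule fps_XD_w)
  have k: "fps_XD (kern a b) = e * kern a b" unfolding e_def w_def by (rule fps_XD_kern)
  have e: "fps_XD e = 2 * of_nat b * w * (1 + 2 * w)"
    by (simp add: e_def fps_XD_mult w mult_ac)
  have one: "fps_XD (1 :: real fps) = 0" by (simp add: fps_XD_def)
  show 2: "fps_XD (fps_XD (kern a b)) = (e\<^sup>2 + 2 * of_nat b * w * (1 + 2 * w)) * kern a b"
    unfolding k fps_XD_mult e by algebra
  show "fps_XD (fps_XD (fps_XD (kern a b))) =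
      (e ^ 3 + 6 * of_nat b * e * w * (1 + 2 * w) + 2 * of_nat b * w * (1 + 2 * w) * (1 + 4 * w))
        * kern a b"
    unfolding 2 by (simp add: k fps_XD_mult e w one power2_eq_square) algebra
qed

text \<open>
  The sum of \<open>p_j(D) (fps_X ^ j * F)\<close>, where \<open>p_j\<close> is the polynomial in front of \<open>A (n - j)\<close> in the
  recurrence: \<open>D\<close> multiplies the coefficient with index \<open>n\<close> by \<open>n\<close>.
\<close>

definition rec_op :: "real fps \<Rightarrow> real fps" where
  "rec_op F =
      (let D = fps_XD; F1 = fps_X * F; F2 = fps_X ^ 2 * F; F3 = fps_X ^ 3 * F; F4 = fps_X ^ 4 * F in
        (384 * D F4 - 256 * F4 - 192 * D (D F4) + 32 * D (D (D F4)))
      + (480 * F3 - 896 * D F3 + 576 * D (D F3) - 128 * D (D (D F3)))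
      + (384 * D F2 - 160 * F2 - 336 * D (D F2) + 112 * D (D (D F2)))
      + (8 * F1 - 32 * D F1 + 48 * D (D F1) - 32 * D (D (D F1)))
      + 2 * D (D (D F)))"

lemma rec_op_nth:
  assumes "n \<ge> 4"
  shows "fps_nth (rec_op F) n =
        (-256 + 384 * real n - 192 * real n ^ 2 + 32 * real n ^ 3) * fps_nth F (n - 4)
      + (480 - 896 * real n + 576 * real n ^ 2 - 128 * real n ^ 3) * fps_nth F (n - 3)
      + (-160 + 384 * real n - 336 * real n ^ 2 + 112 * real n ^ 3) * fps_nth F (n - 2)
      + (8 - 32 * real n + 48 * real n ^ 2 - 32 * real n ^ 3) * fps_nth F (n - 1)
      + 2 * real n ^ 3 * fps_nth F n"
proof -
  have num: "fps_nth (numeral m * f) n = numeral m * fps_nth f n" for m and f :: "real fps"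
    by (simp add: numeral_fps_const)
  have X: "fps_nth (fps_X ^ j * F) n = fps_nth F (n - j)" if "j \<le> 4" for j
    using assms that by (simp add: fps_X_power_mult_nth)
  have X1: "fps_nth (fps_X * F) n = fps_nth F (n - 1)" using X[of 1] by simp
  show ?thesis
    unfolding rec_op_def Let_def
    using assms by (simp add: num X X1) (simp add: algebra_simps power2_eq_square power3_eq_cube)
qed

text \<open>
  The factor by which \<open>rec_op\<close> multiplies \<open>fps_X ^ (2*k) * geo2 ^ (4*k + 2)\<close>, with \<open>x\<close>, \<open>w\<close> and \<open>K\<close>
  in the place of \<open>fps_X\<close>, \<open>fps_X * geo2\<close> and \<open>k\<close>; the functions \<open>e\<close>, \<open>e2\<close> and \<open>e3\<close> give the effect
  of the first three powers of \<open>D\<close> after a shift by \<open>x ^ j\<close>. It has this simple form because the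
  operator is the pullback of the hypergeometric operator
  \<open>\<theta> ^ 3 - 8 * t * (2 * \<theta> + 1) ^ 3\<close> with \<open>\<theta> = t * d/dt\<close>, which annihilates the series of the
  \<open>(2*k choose k) ^ 3 * t ^ k\<close>.
\<close>

lemma symbol_identity:
  fixes x w K :: "'a :: comm_ring_1"
  assumes "w * (1 - 2 * x) = x"
  defines "b \<equiv> 4 * K + 2"
  defines "e \<equiv> (\<lambda>j. 2 * K + j + 2 * b * w)"
  defines "e2 \<equiv> (\<lambda>j. (e j)\<^sup>2 + 2 * b * w * (1 + 2 * w))"
  defines "e3 \<equiv> (\<lambda>j. e j ^ 3 + 6 * b * e j * w * (1 + 2 * w) + 2 * b * w * (1 + 2 * w) * (1 + 4 * w))"
  shows "x ^ 4 * (384 * e 4 - 256 - 192 * e2 4 + 32 * e3 4)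
      + x ^ 3 * (480 - 896 * e 3 + 576 * e2 3 - 128 * e3 3)
      + x ^ 2 * (384 * e 2 - 160 - 336 * e2 2 + 112 * e3 2)
      + x * (8 - 32 * e 1 + 48 * e2 1 - 32 * e3 1)
      + 2 * e3 0
    = 16 * K ^ 3 * (1 + 2 * x) * (1 - 2 * x) ^ 3 - 128 * (2 * K + 1) ^ 3 * (1 + 2 * x) * (x * w)"
    (is "?lhs = ?rhs")
proof -
  \<comment> \<open>The second factor is the quotient of polynomial division by the relation between \<open>w\<close> and \<open>x\<close>.\<close>
  have "?lhs - ?rhs = (w * (1 - 2 * x) - x) *
      (((-8192 * K ^ 3 - 18432 * K ^ 2 - 13312 * K - 3072) * x ^ 3
        + (28672 * K ^ 3 + 64512 * K ^ 2 + 46592 * K + 10752) * x ^ 2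
        + (-14336 * K ^ 3 - 32256 * K ^ 2 - 23296 * K - 5376) * x
        + (1024 * K ^ 3 + 2304 * K ^ 2 + 1664 * K + 384)) * w ^ 2
      + ((-2048 * K ^ 3 - 7680 * K ^ 2 - 7168 * K - 1920) * x ^ 3
        + (9216 * K ^ 3 + 25344 * K ^ 2 + 20736 * K + 5184) * x ^ 2
        + (-9728 * K ^ 3 - 19584 * K ^ 2 - 12928 * K - 2784) * x
        + (768 * K ^ 3 + 1344 * K ^ 2 + 768 * K + 144)) * w
      + ((-512 * K ^ 3 - 768 * K ^ 2 - 768 * K - 256) * x ^ 3
        + (1280 * K ^ 3 + 2304 * K ^ 2 + 1792 * K + 480) * x ^ 2
        + (-896 * K ^ 3 - 1344 * K ^ 2 - 768 * K - 160) * x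
        + (192 * K ^ 3 + 192 * K ^ 2 + 64 * K + 8)))"
    unfolding b_def e_def e2_def e3_def by (simp add: algebra_simps eval_nat_numeral)
  then show ?thesis using assms(1) by simp
qed

text \<open>The series \<open>t ^ k / (1 - 2*x) ^ 2\<close> with \<open>t = x ^ 2 / (1 - 2*x) ^ 4\<close>.\<close>

definition basis_fps :: "nat \<Rightarrow> real fps" where
  "basis_fps k = kern (2 * k) (4 * k + 2)"

lemma basis_fps_Suc: "basis_fps (Suc k) = fps_X ^ 2 * geo2 ^ 4 * basis_fps k"
  unfolding basis_fps_def kern_def by (simp add: power_add power_mult eval_nat_numeral mult_ac)

lemma rec_op_basis_fps:
  "rec_op (basis_fps k) = 16 * (1 + 2 * fps_X) * (1 - 2 * fps_X) ^ 3 *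
     (of_nat k ^ 3 * basis_fps k - 8 * of_nat (2 * k + 1) ^ 3 * basis_fps (Suc k))"
proof -
  define x w where "x = (fps_X :: real fps)" and "w = x * geo2"
  define K :: "real fps" where "K = of_nat k"
  let ?b = "4 * K + 2" and ?f = "basis_fps k"
  define e where "e = (\<lambda>j. 2 * K + j + 2 * ?b * w)"
  define e2 where "e2 = (\<lambda>j. (e j)\<^sup>2 + 2 * ?b * w * (1 + 2 * w))"
  define e3 where "e3 = (\<lambda>j. e j ^ 3 + 6 * ?b * e j * w * (1 + 2 * w) + 2 * ?b * w * (1 + 2 * w) * (1 + 4 * w))"
  have shift: "x ^ j * ?f = kern (2 * k + j) (4 * k + 2)" for j
    by (simp add: basis_fps_def kern_def x_def power_add mult_ac)
  have D: "fps_XD (x ^ j * ?f) = e (of_nat j) * (x ^ j * ?f)"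
       "fps_XD (fps_XD (x ^ j * ?f)) = e2 (of_nat j) * (x ^ j * ?f)"
       "fps_XD (fps_XD (fps_XD (x ^ j * ?f))) = e3 (of_nat j) * (x ^ j * ?f)" for j
  proof -
    have e: "e (of_nat j) = of_nat (2 * k + j) + 2 * of_nat (4 * k + 2) * w" and b: "?b = of_nat (4 * k + 2)"
      by (simp_all add: e_def K_def)
    show "fps_XD (x ^ j * ?f) = e (of_nat j) * (x ^ j * ?f)"
      unfolding shift by (simp only: fps_XD_kern e w_def x_def)
    show "fps_XD (fps_XD (x ^ j * ?f)) = e2 (of_nat j) * (x ^ j * ?f)"
      unfolding shift by (simp only: fps_XD_XD_kern(1) e2_def b e w_def x_def)
    show "fps_XD (fps_XD (fps_XD (x ^ j * ?f))) = e3 (of_nat j) * (x ^ j * ?f)"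
      unfolding shift by (simp only: fps_XD_XD_kern(2) e3_def b e w_def x_def)
  qed
  have D0: "fps_XD ?f = e 0 * ?f" "fps_XD (fps_XD ?f) = e2 0 * ?f"
      "fps_XD (fps_XD (fps_XD ?f)) = e3 0 * ?f"
    using D[of 0] by simp_all
  have D1: "fps_XD (x * ?f) = e 1 * (x * ?f)" "fps_XD (fps_XD (x * ?f)) = e2 1 * (x * ?f)"
      "fps_XD (fps_XD (fps_XD (x * ?f))) = e3 1 * (x * ?f)"
    using D[of 1] by simp_all
  have wx: "w * (1 - 2 * x) = x"
    using geo2_inverse unfolding w_def x_def by algebra
  have "rec_op ?f =
      (x ^ 4 * (384 * e 4 - 256 - 192 * e2 4 + 32 * e3 4)
      + x ^ 3 * (480 - 896 * e 3 + 576 * e2 3 - 128 * e3 3)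
      + x ^ 2 * (384 * e 2 - 160 - 336 * e2 2 + 112 * e3 2)
      + x * (8 - 32 * e 1 + 48 * e2 1 - 32 * e3 1)
      + 2 * e3 0) * ?f"
    unfolding rec_op_def Let_def x_def[symmetric]
    unfolding D(3) D0(3) D1(3) unfolding D(2) D0(2) D1(2) unfolding D(1) D0(1) D1(1)
    by (simp add: algebra_simps)
  also have "\<dots> = (16 * K ^ 3 * (1 + 2 * x) * (1 - 2 * x) ^ 3
      - 128 * (2 * K + 1) ^ 3 * (1 + 2 * x) * (x * w)) * ?f"
    unfolding e_def e2_def e3_def symbol_identity[OF wx] ..
  also have "\<dots> = 16 * (1 + 2 * x) * (1 - 2 * x) ^ 3 *
     (K ^ 3 * ?f - 8 * (2 * K + 1) ^ 3 * (x ^ 2 * geo2 ^ 4 * ?f))"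
  proof -
    have "x * w = (1 - 2 * x) ^ 3 * (x ^ 2 * geo2 ^ 4)"
      using geo2_inverse unfolding w_def x_def by algebra
    then show ?thesis by algebra
  qed
  finally show ?thesis
    by (simp add: basis_fps_Suc x_def K_def add.commute)
qed

section \<open>The sequence as a combination of the basis series\<close>

text \<open>This number is \<open>(2*k choose k) ^ 3\<close>.\<close>

definition cube_coeff :: "nat \<Rightarrow> real" where
  "cube_coeff k = 64 ^ k * half_coeff k ^ 3"

text \<open>The relation that makes the images of the basis series under \<open>rec_op\<close> telescope.\<close>

lemma cube_coeff_Suc:
  "(real k + 1) ^ 3 * cube_coeff (Suc k) = 8 * (2 * real k + 1) ^ 3 * cube_coeff k"
proof -
  have "half_coeff (Suc k) * (2 * (real k + 1)) = half_coeff k * (2 * real k + 1)"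
    by (simp add: half_coeff_Suc)
  then have "(half_coeff (Suc k) * (2 * (real k + 1))) ^ 3 = (half_coeff k * (2 * real k + 1)) ^ 3"
    by (rule arg_cong)
  then show ?thesis
    unfolding cube_coeff_def power_Suc power_mult_distrib by simp
qed

lemma cube_coeff_nonneg: "cube_coeff k \<ge> 0"
  by (simp add: cube_coeff_def half_coeff_nonneg)

lemma fps_nth_basis_fps_eq_0: "n < 2 * k \<Longrightarrow> fps_nth (basis_fps k) n = 0"
  by (simp add: basis_fps_def kern_def fps_X_power_mult_nth)

text \<open>
  The coefficients of \<open>\<Sum>k. cube_coeff k * basis_fps k\<close>; the terms with \<open>k > n\<close> vanish because
  \<open>basis_fps k\<close> begins with \<open>fps_X ^ (2*k)\<close>.
\<close>

definition series_coeff :: "nat \<Rightarrow> real" where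
  "series_coeff n = (\<Sum>k\<le>n. cube_coeff k * fps_nth (basis_fps k) n)"

lemma series_coeff_extend:
  assumes "n \<le> N"
  shows "series_coeff n = (\<Sum>k\<le>N. cube_coeff k * fps_nth (basis_fps k) n)"
  unfolding series_coeff_def using assms
  by (intro sum.mono_neutral_left) (auto simp: fps_nth_basis_fps_eq_0)

text \<open>
  Applied to the sum over \<open>k \<le> n\<close>, the operator leaves the boundary terms \<open>T 0\<close>, which has a
  factor \<open>0 ^ 3\<close>, and \<open>T (n + 1)\<close>, which is divisible by \<open>fps_X ^ (2*n + 2)\<close> and does not
  contribute to the coefficient with index \<open>n\<close>.
\<close>

lemma series_coeff_rec:
  assumes "n \<ge> 4"
  shows "(-256 + 384 * real n - 192 * real n ^ 2 + 32 * real n ^ 3) * series_coeff (n - 4)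
      + (480 - 896 * real n + 576 * real n ^ 2 - 128 * real n ^ 3) * series_coeff (n - 3)
      + (-160 + 384 * real n - 336 * real n ^ 2 + 112 * real n ^ 3) * series_coeff (n - 2)
      + (8 - 32 * real n + 48 * real n ^ 2 - 32 * real n ^ 3) * series_coeff (n - 1)
      + 2 * real n ^ 3 * series_coeff n = 0"
    (is "?lhs = 0")
proof -
  define P :: "real fps" where "P = 16 * (1 + 2 * fps_X) * (1 - 2 * fps_X) ^ 3"
  define T where "T = (\<lambda>k. P * (fps_const (cube_coeff k) * of_nat k ^ 3 * basis_fps k))"
  have step: "fps_const (cube_coeff k) * rec_op (basis_fps k) = T k - T (Suc k)" for k
  proof -
    have "fps_const (cube_coeff k * (8 * (2 * real k + 1) ^ 3)) =
        fps_const (cube_coeff (Suc k) * (real k + 1) ^ 3)"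
      using cube_coeff_Suc[of k] by (simp add: mult_ac)
    also have "fps_const (cube_coeff k * (8 * (2 * real k + 1) ^ 3)) =
        fps_const (cube_coeff k) * (8 * of_nat (2 * k + 1) ^ 3)"
      by (simp add: fps_of_nat[symmetric] numeral_fps_const fps_const_power add.commute)
    also have "fps_const (cube_coeff (Suc k) * (real k + 1) ^ 3) =
        fps_const (cube_coeff (Suc k)) * of_nat (Suc k) ^ 3"
      by (simp add: fps_of_nat[symmetric] fps_const_power add.commute)
    finally show ?thesis
      unfolding rec_op_basis_fps T_def P_def[symmetric] by algebra
  qed
  have T0: "T 0 = 0" by (simp add: T_def)
  have Tn: "fps_nth (T (Suc n)) n = 0"
  proof -
    have "T (Suc n) = fps_X ^ (2 * Suc n) *
        (P * (fps_const (cube_coeff (Suc n)) * of_nat (Suc n) ^ 3 * geo2 ^ (4 * Suc n + 2)))"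
      unfolding T_def basis_fps_def kern_def by (simp only: mult_ac)
    then show ?thesis by (simp only: fps_X_power_mult_nth) simp
  qed
  have "?lhs = (\<Sum>k\<le>n. cube_coeff k * fps_nth (rec_op (basis_fps k)) n)"
    using assms
    by (simp add: series_coeff_extend[of _ n] rec_op_nth sum_distrib_left sum.distrib[symmetric] algebra_simps)
  also have "\<dots> = (\<Sum>k\<le>n. fps_nth (T k) n - fps_nth (T (Suc k)) n)"
  proof (rule sum.cong[OF refl])
    fix k
    have "cube_coeff k * fps_nth (rec_op (basis_fps k)) n = fps_nth (T k - T (Suc k)) n"
      unfolding step[symmetric] by simp
    then show "cube_coeff k * fps_nth (rec_op (basis_fps k)) n = fps_nth (T k) n - fps_nth (T (Suc k)) n"
      by simp
  qed
  also have "\<dots> = 0"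
    using sum_telescope[of "\<lambda>k. fps_nth (T k) n" n] by (simp add: T0 Tn)
  finally show ?thesis .
qed

lemma series_coeff_init:
  "series_coeff 0 = 1" "series_coeff 1 = 4" "series_coeff 2 = 20" "series_coeff 3 = 128"
proof -
  have g: "fps_nth (geo2 ^ 2) n = (real n + 1) * 2 ^ n" for n
  proof -
    have "fps_nth (geo2 ^ 2) n = (\<Sum>i=0..n. 2 ^ n)"
      unfolding power2_eq_square fps_mult_nth geo2_def
      by (intro sum.cong) (simp_all flip: power_add)
    then show ?thesis by simp
  qed
  have b0: "fps_nth (basis_fps 0) n = (real n + 1) * 2 ^ n" for n
    using g by (simp add: basis_fps_def kern_def power2_eq_square)
  have b1: "fps_nth (basis_fps 1) (m + 2) = fps_nth (geo2 ^ 6) m" for m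
    by (simp add: basis_fps_def kern_def fps_X_power_mult_nth)
  have b12: "fps_nth (basis_fps 1) 2 = 1" "fps_nth (basis_fps 1) 3 = 12"
  proof -
    define h where "h = geo2 ^ 2"
    have "geo2 ^ 6 = h * h * h" by (simp add: h_def flip: power_add)
    moreover have "fps_nth h 0 = 1" "fps_nth h 1 = 4"
      using g[of 0] g[of 1] by (simp_all add: h_def)
    then have "fps_nth (h * h * h) 0 = 1" "fps_nth (h * h * h) 1 = 12"
      by (simp_all only: fps_mult_nth_0 fps_mult_nth_1) simp_all
    moreover have "(0::nat) + 2 = 2" "(1::nat) + 2 = 3" by simp_all
    ultimately show "fps_nth (basis_fps 1) 2 = 1" "fps_nth (basis_fps 1) 3 = 12"
      using b1[of 0] b1[of 1] by (simp_all only:)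
  qed
  have c: "cube_coeff 0 = 1" "cube_coeff 1 = 8"
    using cube_coeff_Suc[of 0] by (simp_all add: cube_coeff_def)
  have z: "fps_nth (basis_fps k) n = 0" if "n < 2 * k" for k n
    using that by (rule fps_nth_basis_fps_eq_0)
  show "series_coeff 0 = 1" "series_coeff 1 = 4"
    by (simp_all add: series_coeff_def b0 z c)
  have "{..2::nat} = {0, 1, 2}" "{..3::nat} = {0, 1, 2, 3}" by auto
  then show "series_coeff 2 = 20" "series_coeff 3 = 128"
    using b12 c by (simp_all add: series_coeff_def b0 z)
qed

section \<open>Values of the basis series\<close>

lemma norm_less_conv_radius_geo2:
  fixes x :: real
  assumes "\<bar>x\<bar> < 1/2"
  shows "ereal (norm x) < fps_conv_radius geo2"
proof -
  obtain y where y: "\<bar>x\<bar> < y" "y < 1/2" using assms dense by blast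
  have "summable (\<lambda>n. (2 * y) ^ n)" using y by (intro summable_geometric) auto
  then have radius: "fps_conv_radius geo2 \<ge> norm y"
    unfolding fps_conv_radius_def geo2_def by (intro conv_radius_geI) (simp add: power_mult_distrib)
  have "ereal (norm x) < ereal (norm y)" using y by simp
  then show ?thesis using radius by (rule less_le_trans)
qed

lemma kern_sums:
  assumes "\<bar>x\<bar> < 1/2"
  shows "(\<lambda>n. fps_nth (kern a b) n * x ^ n) sums (x ^ a / (1 - 2 * x) ^ b)"
proof -
  have r: "ereal (norm x) < fps_conv_radius (geo2 ^ b)"
    using norm_less_conv_radius_geo2[OF assms] fps_conv_radius_power less_le_trans by blast
  have r': "ereal (norm x) < fps_conv_radius (kern a b)"
    unfolding kern_def using r fps_conv_radius_mult[of "fps_X ^ a" "geo2 ^ b"] by simp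
  have "(\<lambda>n. (2 * x) ^ n) sums (1 / (1 - 2 * x))"
    using assms by (intro geometric_sums) simp
  then have "eval_fps geo2 x = 1 / (1 - 2 * x)"
    unfolding eval_fps_def geo2_def by (simp add: power_mult_distrib sums_iff)
  then have "eval_fps (kern a b) x = x ^ a * (1 / (1 - 2 * x)) ^ b"
    unfolding kern_def
    by (subst eval_fps_mult[OF _ r]) (simp_all add: eval_fps_power[OF norm_less_conv_radius_geo2[OF assms]])
  then show ?thesis
    using sums_eval_fps[OF r'] by (simp add: power_divide)
qed

lemma kern_deriv_sums:
  assumes "\<bar>x\<bar> < 1/2"
  shows "(\<lambda>n. real n * fps_nth (kern a b) n * x ^ n) sums
    (real a * (x ^ a / (1 - 2 * x) ^ b) + 2 * real b * (x ^ Suc a / (1 - 2 * x) ^ Suc b))"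
proof -
  have "fps_XD (kern a b) = of_nat a * kern a b + of_nat (2 * b) * kern (Suc a) (Suc b)"
    unfolding fps_XD_kern by (simp add: kern_def algebra_simps)
  then have "real n * fps_nth (kern a b) n =
      real a * fps_nth (kern a b) n + 2 * real b * fps_nth (kern (Suc a) (Suc b)) n" for n
    using fps_XD_nth[of "kern a b" n] by (simp flip: fps_of_nat)
  then show ?thesis
    using sums_add[OF sums_mult[OF kern_sums[OF assms], of "real a" a b]
        sums_mult[OF kern_sums[OF assms], of "2 * real b" "Suc a" "Suc b"]]
    by (simp add: algebra_simps)
qed

lemma fps_nth_mult_nonneg:
  fixes f g :: "real fps"
  assumes "\<And>n. fps_nth f n \<ge> 0" "\<And>n. fps_nth g n \<ge> 0"
  shows "fps_nth (f * g) n \<ge> 0"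
  unfolding fps_mult_nth by (intro sum_nonneg mult_nonneg_nonneg assms)

lemma fps_nth_basis_fps_nonneg: "fps_nth (basis_fps k) n \<ge> 0"
proof -
  have "fps_nth (geo2 ^ b) n \<ge> 0" for b n
  proof (induction b arbitrary: n)
    case (Suc b)
    then show ?case
      unfolding power_Suc by (intro fps_nth_mult_nonneg) (auto simp: geo2_def)
  qed (simp add: fps_one_nth)
  then show ?thesis
    unfolding basis_fps_def kern_def fps_X_power_mult_nth by (auto simp del: power_Suc add_2_eq_Suc')
qed

section \<open>Summation of the series\<close>

lemma sums_swap_nonneg:
  fixes g :: "nat \<Rightarrow> nat \<Rightarrow> real"
  assumes nonneg: "\<And>k n. g k n \<ge> 0"
    and rows: "\<And>k. g k sums r k"
    and total: "r sums S"
    and cols: "\<And>n. (\<lambda>k. g k n) sums c n"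
  shows "c sums S"
proof -
  have hs: "(g k has_sum r k) UNIV" for k
    using rows nonneg by (intro sums_nonneg_imp_has_sum)
  have "r k \<ge> 0" for k using rows nonneg sums_le[OF _ sums_zero] by blast
  then have rS: "(r has_sum S) UNIV" using total by (intro sums_nonneg_imp_has_sum)
  have "(\<lambda>(k, n). g k n) summable_on UNIV \<times> UNIV"
    by (rule summable_on_SigmaI[where g = r]) (use hs rS nonneg in \<open>auto simp: summable_on_def\<close>)
  then have "((\<lambda>(k, n). g k n) has_sum S) (UNIV \<times> UNIV)"
    by (intro has_sum_SigmaI[where g = r]) (use hs rS in auto)
  then have "((\<lambda>(n, k). g k n) has_sum S) (UNIV \<times> UNIV)"
    by (subst (asm) has_sum_swap) (simp add: case_prod_unfold)
  then have "(c has_sum S) UNIV"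
  proof (rule has_sum_SigmaD)
    show "((\<lambda>k. case (n, k) of (n, k) \<Rightarrow> g k n) has_sum c n) UNIV" for n
      using cols nonneg by (simp add: sums_nonneg_imp_has_sum)
  qed
  then show ?thesis by (rule has_sum_imp_sums)
qed

text \<open>Both radicands are squares in \<open>\<rat>(sqrt 6)\<close>.\<close>

lemma nested_radicals:
  "sqrt (15 - 6 * sqrt 6) = 3 - sqrt 6"
  "sqrt (1 / 3 * (5 - 2 * sqrt 6)) = 1 - sqrt 6 / 3"
proof -
  have s: "sqrt 6 ^ 2 = (6::real)" "sqrt 6 < (3::real)"
    by (simp_all add: real_less_lsqrt)
  have "sqrt ((3 - sqrt 6)\<^sup>2) = 3 - sqrt 6" "sqrt ((1 - sqrt 6 / 3)\<^sup>2) = 1 - sqrt 6 / 3"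
    using s(2) by simp_all
  moreover have "(3 - sqrt 6)\<^sup>2 = 15 - 6 * sqrt 6" "(1 - sqrt 6 / 3)\<^sup>2 = 1 / 3 * (5 - 2 * sqrt 6)"
    using s(1) by (simp_all add: power2_eq_square algebra_simps)
  ultimately show "sqrt (15 - 6 * sqrt 6) = 3 - sqrt 6"
    "sqrt (1 / 3 * (5 - 2 * sqrt 6)) = 1 - sqrt 6 / 3" by metis+
qed

theorem mainTheorem4:
  fixes A :: "nat \<Rightarrow> real" and B C :: real
  assumes A0: "A 0 = 1" and A1: "A 1 = 4" and A2: "A 2 = 20" and A3: "A 3 = 128"
    and rec: "\<And>n::nat. n \<ge> 4 \<Longrightarrow>
        (-256 + 384 * real n - 192 * real n ^ 2 + 32 * real n ^ 3) * A (n - 4)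
      + (480 - 896 * real n + 576 * real n ^ 2 - 128 * real n ^ 3) * A (n - 3)
      + (-160 + 384 * real n - 336 * real n ^ 2 + 112 * real n ^ 3) * A (n - 2)
      + (8 - 32 * real n + 48 * real n ^ 2 - 32 * real n ^ 3) * A (n - 1)
      + 2 * real n ^ 3 * A n = 0"
    and B: "B = 2 * (-2 + sqrt 6) * sqrt (15 - 6 * sqrt 6)"
    and C: "C = 2 * (-12 + 5 * sqrt 6) * sqrt (1 / 3 * (5 - 2 * sqrt 6))"
  shows "(\<lambda>n. A n * (B * real n + C) * ((5 - 2 * sqrt 6) / 2) ^ n) sums (1 / pi)"
proof -
  have A: "A n = series_coeff n" for n
  proof (induction n rule: less_induct)
    case (less n)
    show ?case
    proof (cases "n \<ge> 4")
      case True
      then have "n - 1 < n" "n - 2 < n" "n - 3 < n" "n - 4 < n" by auto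
      then have "2 * real n ^ 3 * A n = 2 * real n ^ 3 * series_coeff n"
        using rec[OF True] series_coeff_rec[OF True] less[of "n - 1"] less[of "n - 2"]
          less[of "n - 3"] less[of "n - 4"] by (simp only:)
      then show ?thesis using True by simp
    next
      case False
      then have "n = 0 \<or> n = 1 \<or> n = 2 \<or> n = 3" by auto
      then show ?thesis
        using A0 A1 A2 A3 series_coeff_init by metis
    qed
  qed
  define s where "s = sqrt 6"
  have s2: "s\<^sup>2 = 6" by (simp add: s_def)
  then have ss: "s * s = 6" "s * (s * x) = 6 * x" for x
    by (simp_all add: power2_eq_square flip: mult.assoc)
  \<comment> \<open>\<open>C = 18 * s - 44\<close> is positive, but so small that a sharp lower bound is necessary.\<close>
  have s_lower: "22 / 9 < s"
    unfolding s_def by (rule real_less_rsqrt) (simp add: power2_eq_square)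
  have s_upper: "s < 5 / 2"
    unfolding s_def by (rule real_less_lsqrt) (simp_all add: power2_eq_square)
  have "B = 2 * (-2 + s) * (3 - s)" unfolding B nested_radicals s_def ..
  then have Bs: "B = 10 * s - 24" using s2 by algebra
  have "C = 2 * (-12 + 5 * s) * (1 - s / 3)" unfolding C nested_radicals s_def ..
  then have Cs: "C = 18 * s - 44" using s2 by algebra
  define z where "z = (5 - 2 * s) / 2"
  have z: "0 \<le> z" "\<bar>z\<bar> < 1/2" using s_lower s_upper by (auto simp: z_def)
  define r where "r = 1 / (1 - 2 * z)"
  have r: "r = (s + 2) / 4"
  proof -
    have "(s + 2) / 4 * (1 - 2 * z) = 1" 
      unfolding z_def by (simp add: field_simps ss)
    then show ?thesis unfolding r_def using z by (simp add: field_simps)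
  qed
  have r2: "r\<^sup>2 = (5 + 2 * s) / 8"
    unfolding r by (simp add: power2_eq_square field_simps ss)
  have zr2: "z * r\<^sup>2 = 1 / 16"
    unfolding r2 z_def by (simp add: field_simps ss)
  have zr3: "z * r ^ 3 = (s + 2) / 64"
  proof -
    have "z * r ^ 3 = z * r\<^sup>2 * r" by (simp add: eval_nat_numeral)
    then show ?thesis unfolding zr2 by (simp add: r)
  qed
  define g where "g = (\<lambda>k n. cube_coeff k * fps_nth (basis_fps k) n * (B * real n + C) * z ^ n)"
  have rows: "g k sums (half_coeff k ^ 3 * (6 * real k + 1) / 4 ^ k / 4)" for k
  proof -
    let ?a = "2 * k" and ?b = "4 * k + 2"
    \<comment> \<open>The value of the pullback \<open>t\<close> at \<open>z\<close>, where Ramanujan's series appears.\<close>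
    have t: "z ^ 2 * r ^ 4 = 1 / 256"
    proof -
      have "z ^ 2 * r ^ 4 = (z * r\<^sup>2)\<^sup>2" by (simp add: power_mult_distrib flip: power_mult)
      then show ?thesis by (simp add: zr2 power_divide)
    qed
    have E: "z ^ ?a / (1 - 2 * z) ^ ?b = (1 / 256) ^ k * r ^ 2"
        "z ^ Suc ?a / (1 - 2 * z) ^ Suc ?b = (1 / 256) ^ k * (z * r ^ 3)"
      unfolding t[symmetric] r_def
      by (simp_all add: power_mult_distrib power_divide eval_nat_numeral flip: power_mult power_add)
        (simp add: mult_ac)
    have "(\<lambda>n. cube_coeff k * (B * (real n * fps_nth (basis_fps k) n * z ^ n)
        + C * (fps_nth (basis_fps k) n * z ^ n))) sums
        (cube_coeff k * (B * (real ?a * ((1 / 256) ^ k * r ^ 2) + 2 * real ?b * ((1 / 256) ^ k * (z * r ^ 3)))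
        + C * ((1 / 256) ^ k * r ^ 2)))"
      unfolding basis_fps_def E[symmetric]
      by (intro sums_mult sums_add kern_sums kern_deriv_sums z)
    moreover have "cube_coeff k * (B * (real ?a * ((1 / 256) ^ k * r ^ 2)
        + 2 * real ?b * ((1 / 256) ^ k * (z * r ^ 3))) + C * ((1 / 256) ^ k * r ^ 2))
        = half_coeff k ^ 3 * (6 * real k + 1) / 4 ^ k / 4"
    proof -
      have c: "cube_coeff k * (1 / 256) ^ k = half_coeff k ^ 3 / 4 ^ k"
      proof -
        have "(256::real) ^ k = 64 ^ k * 4 ^ k" by (simp flip: power_mult_distrib)
        then show ?thesis by (simp add: cube_coeff_def power_divide)
      qed
      have lin: "B * (real ?a * r ^ 2 + 2 * real ?b * (z * r ^ 3)) + C * r ^ 2 = (6 * real k + 1) / 4"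
        unfolding Bs Cs r2 zr3 by (simp add: field_simps ss)
      have "cube_coeff k * (1 / 256) ^ k * (B * (real ?a * r ^ 2 + 2 * real ?b * (z * r ^ 3)) + C * r ^ 2)
          = half_coeff k ^ 3 * (6 * real k + 1) / 4 ^ k / 4"
        unfolding c lin by simp
      then show ?thesis by (simp only: algebra_simps)
    qed
    ultimately show ?thesis
      unfolding g_def by (simp add: algebra_simps)
  qed
  have total: "(\<lambda>k. half_coeff k ^ 3 * (6 * real k + 1) / 4 ^ k / 4) sums (1 / pi)"
    using sums_divide[OF ramanujan_series, of 4] by simp
  have cols: "(\<lambda>k. g k n) sums (A n * (B * real n + C) * z ^ n)" for n
  proof -
    have "(\<lambda>k. g k n) sums (\<Sum>k\<le>n. g k n)"
      by (rule sums_finite) (auto simp: g_def fps_nth_basis_fps_eq_0)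
    also have "(\<Sum>k\<le>n. g k n) = A n * (B * real n + C) * z ^ n"
      unfolding A series_coeff_def g_def by (simp add: sum_distrib_right)
    finally show ?thesis .
  qed
  have nonneg: "g k n \<ge> 0" for k n
    unfolding g_def using s_lower z
    by (intro mult_nonneg_nonneg add_nonneg_nonneg cube_coeff_nonneg fps_nth_basis_fps_nonneg)
      (auto simp: Bs Cs)
  have "(\<lambda>n. A n * (B * real n + C) * z ^ n) sums (1 / pi)"
    by (rule sums_swap_nonneg[OF nonneg rows total cols])
  then show ?thesis unfolding z_def s_def .
qed

end
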